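(* Let $\lambda=\frac{\ln 3}{\ln 4}$. For every integer $x\geq 2$, $$\frac{2\sqrt{3}}{3}\,x^\lambda\;\leq\; S_{3,0}(3x)\;\leq\;\frac{55}{3}\left(\frac{3}{65}\right)^\lambda x^\lambda .$$
   Context: For a nonnegative integer $n$, $s(n)$ denotes the sum of the binary digits of $n$. For a nonnegative integer $x$, $$S_{3,0}(x)=\sum_{0\leq n<x,\ n\equiv 0 \pmod 3}(-1)^{s(n)},$$ so $S_{3,0}(x)$ is the difference between the numbers of multiples of 3 in $[0,x)$ with even and with odd binary digit sum. *)

theory Defs
  imports Complex_Main
begin

fun bin_digit_sum :: "nat \<Rightarrow> nat" where
  "bin_digit_sum n = (if n = 0 then 0 else n mod 2 + bin_digit_sum (n div 2))"

(* The defining equation loops as a rewrite rule. *)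
declare bin_digit_sum.simps [simp del]

definition S_3_0 :: "nat \<Rightarrow> int" where
  "S_3_0 x = (\<Sum>n | n < x \<and> n mod 3 = 0. (-1) ^ bin_digit_sum n)"

definition newman_exponent :: real where
  "newman_exponent = ln 3 / ln 4"

end

theory Submission
  imports Defs
begin

text \<open>Write \<open>f x\<close> for the sum over the first \<open>x\<close> multiples of 3 and \<open>Q y = f (4 y)\<close>. Then
  \<open>Q (4 y) = 3 Q y\<close>, so \<open>Q\<close> scales like \<open>y\<close> to the power \<open>ln 3 / ln 4\<close>, and the increments of \<open>Q\<close>
  inside the cylinder of numbers whose quaternary expansion starts with that of \<open>y\<close> depend only on
  the signs at \<open>3 y\<close>, \<open>3 y + 1\<close>, \<open>3 y + 2\<close>. Hence \<open>Q\<close> is bounded on every cylinder by its value at the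
  left end plus one of finitely many constants. This already gives both bounds on a finite
  tree of cylinders, except around the extremal points, with expansions \<open>1112222\<dots>\<close> (maximum,
  and the near-maximum \<open>1122222\<dots>\<close>) and \<open>20000\<dots>\<close> (minimum). There the self-similar variation of
  order \<open>3^-j\<close> at depth \<open>j\<close> beats the variation of order \<open>4^-j\<close> of the power function,
  and Bernoulli's inequality suffices.\<close>

section \<open>Signs and self-similarity\<close>

definition thue_morse :: "nat \<Rightarrow> int" where
  "thue_morse n = (-1) ^ bin_digit_sum n"

lemma add_3_eq_Suc:
  "3 + n = Suc (Suc (Suc n))"
  "n + 3 = Suc (Suc (Suc n))"
  by simp_all

lemma bin_digit_sum_0 [simp]: "bin_digit_sum 0 = 0"
  by (subst bin_digit_sum.simps) simp

lemma bin_digit_sum_double: "bin_digit_sum (2 * n) = bin_digit_sum n"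
  by (cases "n = 0") (simp_all add: bin_digit_sum.simps[of "2 * n"])

lemma bin_digit_sum_double_Suc: "bin_digit_sum (2 * n + 1) = Suc (bin_digit_sum n)"
  by (subst bin_digit_sum.simps) simp

lemma thue_morse_0 [simp]: "thue_morse 0 = 1"
  by (simp add: thue_morse_def)

lemma thue_morse_double: "thue_morse (2 * n) = thue_morse n"
  by (simp add: thue_morse_def bin_digit_sum_double)

lemma thue_morse_double_Suc: "thue_morse (2 * n + 1) = - thue_morse n"
  unfolding thue_morse_def bin_digit_sum_double_Suc by simp

lemma thue_morse_quad:
  "thue_morse (4 * n) = thue_morse n"
  "thue_morse (4 * n + 1) = - thue_morse n"
  "thue_morse (4 * n + 2) = - thue_morse n"
  "thue_morse (4 * n + 3) = thue_morse n"
  using thue_morse_double[of n] thue_morse_double_Suc[of n]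
    thue_morse_double[of "2 * n"] thue_morse_double_Suc[of "2 * n"]
    thue_morse_double[of "2 * n + 1"] thue_morse_double_Suc[of "2 * n + 1"]
  by (simp_all add: algebra_simps add_3_eq_Suc)

lemma thue_morse_numeral [simp]:
  "thue_morse (numeral (Num.Bit0 n)) = thue_morse (numeral n)"
  "thue_morse (numeral (Num.Bit1 n)) = - thue_morse (numeral n)"
  "thue_morse 1 = -1"
  "thue_morse (Suc 0) = -1"
  "thue_morse (Suc (Suc 0)) = -1"
proof -
  show "thue_morse (numeral (Num.Bit0 n)) = thue_morse (numeral n)"
    using thue_morse_double[of "numeral n"] by (simp only: numeral_Bit0[of n] mult_2)
  show "thue_morse (numeral (Num.Bit1 n)) = - thue_morse (numeral n)"
    using thue_morse_double_Suc[of "numeral n"] by (simp only: numeral_Bit1[of n] mult_2)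
  show "thue_morse 1 = -1" "thue_morse (Suc 0) = -1"
    using thue_morse_double_Suc[of 0] by simp_all
  then show "thue_morse (Suc (Suc 0)) = -1"
    using thue_morse_double[of 1] by (simp add: numeral_2_eq_2)
qed

lemma thue_morse_cases: "thue_morse n = 1 \<or> thue_morse n = -1"
  by (simp add: thue_morse_def minus_one_power_iff)

definition newman_sum :: "nat \<Rightarrow> int" where
  "newman_sum x = (\<Sum>n<x. thue_morse (3 * n))"

lemma S_3_0_mult_3: "S_3_0 (3 * x) = newman_sum x"
proof -
  have "{n. n < 3 * x \<and> n mod 3 = 0} = (*) 3 ` {..<x}"
    by (auto elim!: dvdE simp: mod_eq_0_iff_dvd)
  then show ?thesis
    unfolding S_3_0_def newman_sum_def thue_morse_def
    by (simp add: sum.reindex inj_on_def)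
qed

lemma newman_sum_0 [simp]: "newman_sum 0 = 0"
  by (simp add: newman_sum_def)

lemma newman_sum_Suc: "newman_sum (Suc x) = newman_sum x + thue_morse (3 * x)"
  by (simp add: newman_sum_def)

text \<open>Exact scaling by 3 holds only on multiples of four: \<open>newman_sum 1 = 1\<close> and
  \<open>newman_sum 4 = 4\<close>, but \<open>newman_quad 1 = 4\<close> and
  \<open>newman_quad 4 = 12\<close>.\<close>

definition newman_quad :: "nat \<Rightarrow> int" where
  "newman_quad y = newman_sum (4 * y)"

text \<open>Each argument equals \<open>4 * (3 * y + j) + s\<close> with \<open>j\<close> at most 2,
  so the sign triple of a child is a function of the triple of \<open>y\<close>: a finite automaton
  on triples.\<close>

lemma thue_morse_triple_quad:
  "thue_morse (3 * (4 * y)) = thue_morse (3 * y)"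
  "thue_morse (3 * (4 * y) + 1) = - thue_morse (3 * y)"
  "thue_morse (3 * (4 * y) + 2) = - thue_morse (3 * y)"
  "thue_morse (3 * (4 * y + 1)) = thue_morse (3 * y)"
  "thue_morse (3 * (4 * y + 1) + 1) = thue_morse (3 * y + 1)"
  "thue_morse (3 * (4 * y + 1) + 2) = - thue_morse (3 * y + 1)"
  "thue_morse (3 * (4 * y + 2)) = - thue_morse (3 * y + 1)"
  "thue_morse (3 * (4 * y + 2) + 1) = thue_morse (3 * y + 1)"
  "thue_morse (3 * (4 * y + 2) + 2) = thue_morse (3 * y + 2)"
  "thue_morse (3 * (4 * y + 3)) = - thue_morse (3 * y + 2)"
  "thue_morse (3 * (4 * y + 3) + 1) = - thue_morse (3 * y + 2)"
  "thue_morse (3 * (4 * y + 3) + 2) = thue_morse (3 * y + 2)"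
  using thue_morse_quad[of "3 * y"] thue_morse_quad[of "3 * y + 1"] thue_morse_quad[of "3 * y + 2"]
  by (simp_all add: algebra_simps)

lemma newman_sum_quad:
  "newman_sum (4 * y) = newman_quad y"
  "newman_sum (4 * y + 1) = newman_quad y + thue_morse (3 * y)"
  "newman_sum (4 * y + 2) = newman_quad y + 2 * thue_morse (3 * y)"
  "newman_sum (4 * y + 3) = newman_quad y + 2 * thue_morse (3 * y) - thue_morse (3 * y + 1)"
  using newman_sum_Suc[of "4 * y"] newman_sum_Suc[of "4 * y + 1"] newman_sum_Suc[of "4 * y + 2"]
    thue_morse_triple_quad(1,4,7)[of y]
  by (simp_all add: newman_quad_def add_3_eq_Suc)

lemma newman_quad_Suc:
  "newman_quad (Suc y) = newman_quad y
     + 2 * thue_morse (3 * y) - thue_morse (3 * y + 1) - thue_morse (3 * y + 2)"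
proof -
  have "newman_quad (Suc y) = newman_sum (4 * y + 3) + thue_morse (3 * (4 * y + 3))"
    using newman_sum_Suc[of "4 * y + 3"] by (simp add: newman_quad_def algebra_simps)
  then show ?thesis
    using thue_morse_triple_quad(10)[of y] newman_sum_quad(4)[of y] by simp
qed

lemma newman_quad_0 [simp]: "newman_quad 0 = 0"
  by (simp add: newman_quad_def)

lemma newman_quad_1 [simp]: "newman_quad 1 = 4" "newman_quad (Suc 0) = 4"
  using newman_quad_Suc[of 0] by simp_all

lemma newman_quad_steps:
  "newman_quad (4 * y + 1) = newman_quad (4 * y) + 4 * thue_morse (3 * y)"
  "newman_quad (4 * y + 2) = newman_quad (4 * y) + 6 * thue_morse (3 * y)"
  "newman_quad (4 * y + 3) = newman_quad (4 * y)
     + 6 * thue_morse (3 * y) - 3 * thue_morse (3 * y + 1) - thue_morse (3 * y + 2)"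
  "newman_quad (4 * Suc y) = newman_quad (4 * y)
     + 6 * thue_morse (3 * y) - 3 * thue_morse (3 * y + 1) - 3 * thue_morse (3 * y + 2)"
proof -
  note t = thue_morse_triple_quad[of y]
  show 1: "newman_quad (4 * y + 1) = newman_quad (4 * y) + 4 * thue_morse (3 * y)"
    using newman_quad_Suc[of "4 * y"] t by simp
  have "Suc (4 * y + 1) = 4 * y + 2" by simp
  with 1 show 2: "newman_quad (4 * y + 2) = newman_quad (4 * y) + 6 * thue_morse (3 * y)"
    using newman_quad_Suc[of "4 * y + 1"] unfolding t by (simp add: add_3_eq_Suc)
  have "Suc (4 * y + 2) = 4 * y + 3" by simp
  with 2 show 3: "newman_quad (4 * y + 3) = newman_quad (4 * y)
     + 6 * thue_morse (3 * y) - 3 * thue_morse (3 * y + 1) - thue_morse (3 * y + 2)"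
    using newman_quad_Suc[of "4 * y + 2"] unfolding t by (simp add: add_3_eq_Suc)
  have eq: "4 * Suc y = Suc (4 * y + 3)" by simp
  from 3 show "newman_quad (4 * Suc y) = newman_quad (4 * y)
     + 6 * thue_morse (3 * y) - 3 * thue_morse (3 * y + 1) - 3 * thue_morse (3 * y + 2)"
    using newman_quad_Suc[of "4 * y + 3"] unfolding t eq by (simp add: add_3_eq_Suc)
qed

text \<open>With signs \<open>e0, e1, e2\<close> at \<open>3 * y, 3 * y + 1, 3 * y + 2\<close>, four
  steps add \<open>6 * e0 - 3 * e1 - 3 * e2\<close>, three times the single increment
  \<open>2 * e0 - e1 - e2\<close>.\<close>

lemma newman_quad_mult_4: "newman_quad (4 * y) = 3 * newman_quad y"
proof (induction y)
  case (Suc y)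
  then show ?case
    using newman_quad_steps(4)[of y] newman_quad_Suc[of y] by (simp del: mult_Suc_right)
qed simp

lemma newman_quad_quad:
  "newman_quad (4 * y + 1) = 3 * newman_quad y + 4 * thue_morse (3 * y)"
  "newman_quad (4 * y + 2) = 3 * newman_quad y + 6 * thue_morse (3 * y)"
  "newman_quad (4 * y + 3) = 3 * newman_quad y
     + 6 * thue_morse (3 * y) - 3 * thue_morse (3 * y + 1) - thue_morse (3 * y + 2)"
  by (simp_all only: newman_quad_steps newman_quad_mult_4)

section \<open>Evaluation at numerals, reading two bits as one quaternary digit\<close>

lemma quad_numeral:
  "numeral (Num.Bit0 (Num.Bit0 n)) = 4 * (numeral n :: nat)"
  "numeral (Num.Bit1 (Num.Bit0 n)) = 4 * (numeral n :: nat) + 1"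
  "numeral (Num.Bit0 (Num.Bit1 n)) = 4 * (numeral n :: nat) + 2"
  "numeral (Num.Bit1 (Num.Bit1 n)) = 4 * (numeral n :: nat) + 3"
  by (simp_all only: numeral.simps ring_distribs mult_1_left add_ac)

lemma newman_quad_numeral [simp]:
  "newman_quad (numeral (Num.Bit0 (Num.Bit0 n))) = 3 * newman_quad (numeral n)"
  "newman_quad (numeral (Num.Bit1 (Num.Bit0 n))) =
     3 * newman_quad (numeral n) + 4 * thue_morse (3 * numeral n)"
  "newman_quad (numeral (Num.Bit0 (Num.Bit1 n))) =
     3 * newman_quad (numeral n) + 6 * thue_morse (3 * numeral n)"
  "newman_quad (numeral (Num.Bit1 (Num.Bit1 n))) =
     3 * newman_quad (numeral n) + 6 * thue_morse (3 * numeral n)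
       - 3 * thue_morse (3 * numeral n + 1) - thue_morse (3 * numeral n + 2)"
  by (simp_all only: quad_numeral[of n] newman_quad_quad newman_quad_mult_4)

lemma newman_quad_2_3 [simp]: "newman_quad 2 = 6" "newman_quad 3 = 10"
  using newman_quad_quad(2,3)[of 0] by (simp_all del: add_2_eq_Suc')

lemma newman_sum_numeral [simp]:
  "newman_sum (numeral (Num.Bit0 (Num.Bit0 n))) = newman_quad (numeral n)"
  "newman_sum (numeral (Num.Bit1 (Num.Bit0 n))) =
     newman_quad (numeral n) + thue_morse (3 * numeral n)"
  "newman_sum (numeral (Num.Bit0 (Num.Bit1 n))) =
     newman_quad (numeral n) + 2 * thue_morse (3 * numeral n)"
  "newman_sum (numeral (Num.Bit1 (Num.Bit1 n))) =
     newman_quad (numeral n) + 2 * thue_morse (3 * numeral n) - thue_morse (3 * numeral n + 1)"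
  by (simp_all only: quad_numeral[of n] newman_sum_quad)

lemma newman_sum_2_3 [simp]: "newman_sum 2 = 2" "newman_sum 3 = 3"
  using newman_sum_quad(3,4)[of 0] by (simp_all del: add_2_eq_Suc')

section \<open>Extreme values over quaternary cylinders\<close>

text \<open>The supremum of \<open>newman_quad (4 ^ k * y + b) / 3 ^ k - newman_quad y\<close> over \<open>b < 4 ^ k\<close>, when
  the signs at \<open>3 y\<close>, \<open>3 y + 1\<close>, \<open>3 y + 2\<close> are the three arguments. The triples with three equal signs do not occur; their values are chosen so
  that \<open>cyl_sup_quad\<close> holds without excluding them.\<close>

fun max_rise :: "int \<Rightarrow> int \<Rightarrow> int \<Rightarrow> int" where
  "max_rise a b c = (if a = 1 then if b = 1 then 2 else if c = 1 then 3 else 4 else 0)"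

definition cyl_sup :: "nat \<Rightarrow> int" where
  "cyl_sup y = newman_quad y
     + max_rise (thue_morse (3 * y)) (thue_morse (3 * y + 1)) (thue_morse (3 * y + 2))"

text \<open>Negating all three signs negates every increment, so the largest drop is the largest
  rise of the negated triple.\<close>

definition cyl_inf :: "nat \<Rightarrow> int" where
  "cyl_inf y = newman_quad y
     - max_rise (- thue_morse (3 * y)) (- thue_morse (3 * y + 1)) (- thue_morse (3 * y + 2))"

lemma less_4_cases:
  assumes "r < (4::nat)"
  obtains "r = 0" | "r = 1" | "r = 2" | "r = 3"
  using assms by linarith

lemma cyl_sup_quad:
  assumes "r < 4"
  shows "cyl_sup (4 * y + r) \<le> 3 * cyl_sup y"
  using assms thue_morse_cases[of "3 * y"] thue_morse_cases[of "3 * y + 1"]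
      thue_morse_cases[of "3 * y + 2"]
  unfolding cyl_sup_def
  by (cases r rule: less_4_cases)
     (auto simp only: newman_quad_quad newman_quad_mult_4 thue_morse_triple_quad add_0_right,
      simp_all)

lemma cyl_inf_quad:
  assumes "r < 4"
  shows "cyl_inf (4 * y + r) \<ge> 3 * cyl_inf y"
  using assms thue_morse_cases[of "3 * y"] thue_morse_cases[of "3 * y + 1"]
      thue_morse_cases[of "3 * y + 2"]
  unfolding cyl_inf_def
  by (cases r rule: less_4_cases)
     (auto simp only: newman_quad_quad newman_quad_mult_4 thue_morse_triple_quad add_0_right,
      simp_all)

text \<open>The last digit only selects a partial block sum added to \<open>newman_quad y\<close>;
  the four cases are checked for all sign triples.\<close>

lemma cyl_inf_le_newman_sum:
  assumes "r < 4"
  shows "cyl_inf y \<le> newman_sum (4 * y + r)"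
  using assms thue_morse_cases[of "3 * y"] thue_morse_cases[of "3 * y + 1"]
      thue_morse_cases[of "3 * y + 2"]
  unfolding cyl_inf_def
  by (cases r rule: less_4_cases) (auto simp only: newman_sum_quad add_0_right, simp_all)

lemma newman_quad_le_cyl_sup: "newman_quad y \<le> cyl_sup y"
  by (simp add: cyl_sup_def)

lemma cylinder_last_digit:
  "4 ^ Suc k * a + b = 4 * (4 ^ k * a + b div 4) + b mod (4::nat)"
  using mult_div_mod_eq[of 4 b] by simp

lemma cylinder_first_digit:
  "4 ^ Suc k * a + b = 4 ^ k * (4 * a + b div 4 ^ k) + b mod (4 ^ k :: nat)"
  using mult_div_mod_eq[of "4 ^ k" b] by (simp add: algebra_simps)

lemma cyl_sup_cylinder: "b < 4 ^ k \<Longrightarrow> cyl_sup (4 ^ k * a + b) \<le> 3 ^ k * cyl_sup a"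
proof (induction k arbitrary: b)
  case (Suc k)
  have "cyl_sup (4 ^ Suc k * a + b) \<le> 3 * cyl_sup (4 ^ k * a + b div 4)"
    unfolding cylinder_last_digit by (rule cyl_sup_quad) simp
  also have "\<dots> \<le> 3 * (3 ^ k * cyl_sup a)"
    using Suc.IH[of "b div 4"] Suc.prems by simp
  finally show ?case by simp
qed simp

lemma cyl_inf_cylinder: "b < 4 ^ k \<Longrightarrow> cyl_inf (4 ^ k * a + b) \<ge> 3 ^ k * cyl_inf a"
proof (induction k arbitrary: b)
  case (Suc k)
  have "3 * (3 ^ k * cyl_inf a) \<le> 3 * cyl_inf (4 ^ k * a + b div 4)"
    using Suc.IH[of "b div 4"] Suc.prems by simp
  also have "\<dots> \<le> cyl_inf (4 ^ Suc k * a + b)"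
    unfolding cylinder_last_digit by (rule cyl_inf_quad) simp
  finally show ?case by simp
qed simp

text \<open>The last of the \<open>Suc k\<close> digits is spent on passing from
  \<open>newman_quad\<close> to \<open>newman_sum\<close>, hence the factor
  \<open>3 ^ k\<close>.\<close>

lemma newman_sum_cylinder:
  assumes "b < 4 ^ Suc k"
  shows "3 ^ k * cyl_inf a \<le> newman_sum (4 ^ Suc k * a + b)"
proof -
  have "3 ^ k * cyl_inf a \<le> cyl_inf (4 ^ k * a + b div 4)"
    using assms by (intro cyl_inf_cylinder) simp
  also have "\<dots> \<le> newman_sum (4 ^ Suc k * a + b)"
    unfolding cylinder_last_digit by (rule cyl_inf_le_newman_sum) simp
  finally show ?thesis .
qed

text \<open>Drop trailing quaternary digits until the prefix is below \<open>4 * m\<close>. This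
  reduces each bound to finitely many root cylinders.\<close>

lemma cylinder_exists:
  fixes x m :: nat
  assumes "0 < m" "m \<le> x"
  shows "\<exists>k a b. m \<le> a \<and> a < 4 * m \<and> b < 4 ^ k \<and> x = 4 ^ k * a + b"
  using assms(2)
proof (induction x rule: less_induct)
  case (less x)
  show ?case
  proof (cases "x < 4 * m")
    case True
    then show ?thesis
      using less.prems by (intro exI[of _ 0] exI[of _ x]) simp
  next
    case False
    then have "x div 4 < x" "m \<le> x div 4"
      using assms(1) by auto
    from less.IH[OF this] obtain k a b
      where *: "m \<le> a" "a < 4 * m" "b < 4 ^ k" "x div 4 = 4 ^ k * a + b"
      by blast
    have "x = 4 ^ Suc k * a + (4 * b + x mod 4)"
      using *(4) mult_div_mod_eq[of 4 x] by simp
    moreover have "4 * b + x mod 4 < 4 ^ Suc k"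
      using *(3) mod_less_divisor[of 4 x] by simp
    ultimately show ?thesis
      using * by blast
  qed
qed

section \<open>The exponent\<close>

text \<open>Equivalent to \<open>4 ^ 19 \<le> 3 ^ 24\<close> and \<open>3 ^ 5 \<le> 4 ^ 4\<close>.
  The lower bound must be this sharp: the near-maximum at 362 compares 57/55 with a power of 68/65,
  which needs an exponent of about 0.79162.\<close>

lemma newman_exponent_bounds: "19 / 24 \<le> newman_exponent" "newman_exponent \<le> 4 / 5"
proof -
  have "ln ((4::real) ^ 19) \<le> ln (3 ^ 24)" "ln ((3::real) ^ 5) \<le> ln (4 ^ 4)"
    by (subst ln_le_cancel_iff; simp)+
  then have "19 * ln (4::real) \<le> 24 * ln 3" "5 * ln (3::real) \<le> 4 * ln 4"
    by (simp_all only: ln_realpow zero_less_numeral of_nat_numeral)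
  then show "19 / 24 \<le> newman_exponent" "newman_exponent \<le> 4 / 5"
    by (simp_all add: newman_exponent_def field_simps)
qed

lemma powr_newman_exponent_4: "4 powr newman_exponent = 3"
  by (simp add: newman_exponent_def powr_def)

lemma powr_newman_exponent_2: "2 powr newman_exponent = sqrt 3"
proof -
  have "(2 powr newman_exponent)\<^sup>2 = 3"
    using powr_mult[of 2 2 newman_exponent] powr_newman_exponent_4 by (simp add: power2_eq_square)
  then show ?thesis
    by (intro real_sqrt_unique[symmetric]) simp_all
qed

lemma powr_newman_exponent_mult_4_power:
  assumes "0 \<le> z"
  shows "(4 ^ k * z) powr newman_exponent = 3 ^ k * z powr newman_exponent"
proof (induction k)
  case (Suc k)
  have "(4 ^ Suc k * z) powr newman_exponent = (4 * (4 ^ k * z)) powr newman_exponent"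
    by (simp add: mult.assoc)
  then show ?case
    using Suc assms by (simp add: powr_mult powr_newman_exponent_4)
qed simp

lemma powr_newman_exponent_mono:
  assumes "0 \<le> x" "x \<le> y"
  shows "x powr newman_exponent \<le> y powr newman_exponent"
  using assms newman_exponent_bounds by (intro powr_mono2) auto

lemma le_powr_of_power_le:
  fixes t v s :: real
  assumes "0 < t" "0 < n" "v ^ n \<le> t ^ m" "t powr (real m / real n) \<le> t powr s"
  shows "v \<le> t powr s"
proof -
  have "(t powr (real m / real n)) ^ n = (t powr (real m / real n)) powr real n"
    using assms(1) by (intro powr_realpow[symmetric]) simp
  also have "\<dots> = t powr real m"
    using assms(2) by (simp add: powr_powr)
  also have "\<dots> = t ^ m"
    using assms(1) by (rule powr_realpow)
  finally have "v ^ n \<le> (t powr (real m / real n)) ^ n"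
    using assms(3) by simp
  then have "v \<le> t powr (real m / real n)"
    using power_strict_mono[of "t powr (real m / real n)" v n] assms(2)
    by (meson leD leI powr_ge_zero)
  with assms(4) show ?thesis by simp
qed

text \<open>Replacing the exponent by a rational one decreases the power if it is raised for
  \<open>t \<le> 1\<close> or lowered for \<open>t \<ge> 1\<close>; what remains is a comparison of
  integer powers.\<close>

lemma le_powr_newman_exponent:
  assumes "0 < t" "t \<le> 1 \<and> v ^ 5 \<le> t ^ 4 \<or> 1 \<le> t \<and> v ^ 24 \<le> t ^ 19"
  shows "v \<le> t powr newman_exponent"
  using assms(2)
proof
  assume "t \<le> 1 \<and> v ^ 5 \<le> t ^ 4"
  moreover have "t powr (real 4 / real 5) \<le> t powr newman_exponent"
    using calculation assms(1) newman_exponent_bounds by (intro powr_mono') simp_all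
  ultimately show ?thesis
    using assms(1) by (intro le_powr_of_power_le[of t 5 v 4]) (blast | rule zero_less_numeral)+
next
  assume "1 \<le> t \<and> v ^ 24 \<le> t ^ 19"
  moreover have "t powr (real 19 / real 24) \<le> t powr newman_exponent"
    using calculation assms(1) newman_exponent_bounds by (intro powr_mono) simp_all
  ultimately show ?thesis
    using assms(1) by (intro le_powr_of_power_le[of t 24 v 19]) (blast | rule zero_less_numeral)+
qed

lemma powr_newman_exponent_le:
  assumes "1 \<le> t" "t ^ 4 \<le> v ^ 5" "0 \<le> v"
  shows "t powr newman_exponent \<le> v"
proof -
  have "t powr newman_exponent \<le> t powr (4 / 5)"
    using assms(1) newman_exponent_bounds by (intro powr_mono) auto
  moreover have "(t powr (4 / 5)) ^ 5 = (t powr (4 / 5)) powr real 5"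
    using assms(1) by (intro powr_realpow[symmetric]) simp
  moreover have "\<dots> = t powr real 4"
    by (simp add: powr_powr)
  moreover have "\<dots> = t ^ 4"
    using assms(1) by (intro powr_realpow) simp
  ultimately show ?thesis
    using assms power_mono_iff[of "t powr (4 / 5)" v 5] by simp
qed

text \<open>Bernoulli's inequality in weak form: the exponent is at most 1 and
  \<open>1 + d / z\<close> at least 1.\<close>

lemma powr_newman_exponent_shift_le:
  assumes "0 < z" "0 \<le> d"
  shows "(z + d) powr newman_exponent \<le> z powr newman_exponent * (1 + d / z)"
proof -
  have "(z + d) powr newman_exponent = z powr newman_exponent * (1 + d / z) powr newman_exponent"
    using assms by (subst powr_mult[symmetric]) (auto simp: distrib_left right_diff_distrib)
  moreover have "(1 + d / z) powr newman_exponent \<le> (1 + d / z) powr 1"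
    using assms newman_exponent_bounds by (intro powr_mono) auto
  ultimately show ?thesis
    using assms by (simp add: mult_left_mono)
qed

lemma powr_newman_exponent_shift_ge:
  assumes "0 < z" "0 \<le> d" "d \<le> z"
  shows "z powr newman_exponent * (1 - d / z) \<le> (z - d) powr newman_exponent"
proof -
  have "(z - d) powr newman_exponent = z powr newman_exponent * (1 - d / z) powr newman_exponent"
    using assms by (subst powr_mult[symmetric]) (auto simp: distrib_left right_diff_distrib)
  moreover have "(1 - d / z) powr 1 \<le> (1 - d / z) powr newman_exponent"
    using assms newman_exponent_bounds by (intro powr_mono') auto
  ultimately show ?thesis
    using assms by (simp add: mult_left_mono)
qed

section \<open>The upper bound\<close>

text \<open>Three times the constant of the theorem, as \<open>newman_quad y\<close> is
  \<open>newman_sum\<close> at \<open>4 * y\<close>. Here 21 is 111 in base 4, 55 is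
  \<open>newman_quad 21 + 3\<close>, and 65/3 is 21 + 2/3, the extremal point.\<close>

definition upper_const :: real where
  "upper_const = 55 * (3 / 65) powr newman_exponent"

definition upper_cyl :: "nat \<Rightarrow> bool" where
  "upper_cyl a \<longleftrightarrow> (\<forall>k b. b < 4 ^ k \<longrightarrow>
     real_of_int (newman_quad (4 ^ k * a + b))
       \<le> upper_const * real (4 ^ k * a + b) powr newman_exponent)"

lemma upper_const_pos: "0 < upper_const"
  by (simp add: upper_const_def)

lemma upper_const_powr:
  assumes "0 \<le> z"
  shows "upper_const * z powr newman_exponent
    = 55 * 3 ^ j * (3 * z / (65 * 4 ^ j)) powr newman_exponent"
proof -
  have "z powr newman_exponent = 3 ^ j * (z / 4 ^ j) powr newman_exponent"
    using assms powr_newman_exponent_mult_4_power[of "z / 4 ^ j" j] by simp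
  moreover have "(3 / 65) powr newman_exponent * (z / 4 ^ j) powr newman_exponent
      = (3 * z / (65 * 4 ^ j)) powr newman_exponent"
    using assms by (subst powr_mult[symmetric]) simp_all
  ultimately show ?thesis
    by (simp add: upper_const_def)
qed

text \<open>Choosing \<open>j\<close> so that \<open>z\<close> is close to
  \<open>65 / 3 * 4 ^ j\<close> brings the base close to 1, where rational exponents lose little; at
  the extremal point it is exactly 1.\<close>

lemma le_upper_const_powr:
  fixes z v :: real
  assumes "0 < z"
    and "3 * z \<le> 65 * 4 ^ j \<and> (v / (55 * 3 ^ j)) ^ 5 \<le> (3 * z / (65 * 4 ^ j)) ^ 4
       \<or> 65 * 4 ^ j \<le> 3 * z \<and> (v / (55 * 3 ^ j)) ^ 24 \<le> (3 * z / (65 * 4 ^ j)) ^ 19"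
  shows "v \<le> upper_const * z powr newman_exponent"
proof -
  have "v / (55 * 3 ^ j) \<le> (3 * z / (65 * 4 ^ j)) powr newman_exponent"
    using assms by (intro le_powr_newman_exponent) (auto simp: field_simps)
  then show ?thesis
    using assms(1) by (simp add: upper_const_powr[of z j] field_simps)
qed

text \<open>Compares the supremum over the whole cylinder with the power at its left end, where the
  power is smallest.\<close>

lemma upper_cyl_leaf:
  assumes "real_of_int (cyl_sup a) \<le> upper_const * real a powr newman_exponent"
  shows "upper_cyl a"
  unfolding upper_cyl_def
proof (intro allI impI)
  fix k b :: nat
  assume "b < 4 ^ k"
  then have "newman_quad (4 ^ k * a + b) \<le> 3 ^ k * cyl_sup a"
    using newman_quad_le_cyl_sup cyl_sup_cylinder order_trans by blast
  then have "real_of_int (newman_quad (4 ^ k * a + b)) \<le> 3 ^ k * real_of_int (cyl_sup a)"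
    by (metis of_int_le_iff of_int_mult of_int_numeral of_int_power)
  also have "\<dots> \<le> 3 ^ k * (upper_const * real a powr newman_exponent)"
    using assms by simp
  also have "\<dots> = upper_const * (4 ^ k * real a) powr newman_exponent"
    by (simp add: powr_newman_exponent_mult_4_power)
  also have "\<dots> \<le> upper_const * real (4 ^ k * a + b) powr newman_exponent"
    using upper_const_pos by (intro mult_left_mono powr_newman_exponent_mono) auto
  finally show "real_of_int (newman_quad (4 ^ k * a + b))
      \<le> upper_const * real (4 ^ k * a + b) powr newman_exponent" .
qed

lemma upper_cyl_node:
  assumes "upper_cyl (4 * a)" "upper_cyl (4 * a + 1)" "upper_cyl (4 * a + 2)" "upper_cyl (4 * a + 3)"
  shows "upper_cyl a"
  unfolding upper_cyl_def
proof (intro allI impI)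
  fix k b :: nat
  assume b: "b < 4 ^ k"
  show "real_of_int (newman_quad (4 ^ k * a + b))
      \<le> upper_const * real (4 ^ k * a + b) powr newman_exponent"
  proof (cases k)
    case 0
    \<comment> \<open>With no digit appended, the bound at \<open>a\<close> follows from the child
      \<open>4 * a\<close>, since both sides scale by 3.\<close>
    have "real_of_int (newman_quad (4 ^ 0 * (4 * a) + 0))
        \<le> upper_const * real (4 ^ 0 * (4 * a) + 0) powr newman_exponent"
      using assms(1) unfolding upper_cyl_def by (metis zero_less_one power_0)
    then show ?thesis
      using 0 b powr_newman_exponent_mult_4_power[of "real a" 1] by (simp add: newman_quad_mult_4)
  next
    case (Suc m)
    have "b div 4 ^ m < 4"
      using b Suc by (simp add: less_mult_imp_div_less)
    then have "upper_cyl (4 * a + b div 4 ^ m)"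
      using assms by (cases rule: less_4_cases) simp_all
    moreover have "b mod 4 ^ m < 4 ^ m" by simp
    ultimately show ?thesis
      unfolding Suc cylinder_first_digit upper_cyl_def by blast
  qed
qed

text \<open>The cylinder of \<open>a\<close> attains its maximum at \<open>a + 2 / 3\<close>, whose quaternary expansion
  after the point is \<open>222\<dots>\<close>; descending along the digit 2 reproduces the hypotheses.\<close>

lemma upper_cyl_chain:
  assumes "thue_morse (3 * a) = 1" "thue_morse (3 * a + 1) = -1" "thue_morse (3 * a + 2) = 1"
    and "real_of_int (newman_quad a + 3) \<le> upper_const * (real a + 2 / 3) powr newman_exponent"
    and "5 * real_of_int (newman_quad a + 3) \<le> 8 * (real a + 2 / 3)"
  shows "upper_cyl a"
proof -
  \<comment> \<open>Moving left from \<open>z\<close> by \<open>d\<close> loses at most the fraction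
    \<open>d / z\<close> of the power, so a drop of at least \<open>c * d\<close> in the value, with
    \<open>w / z \<le> c\<close>, compensates.\<close>
  have near_max: "v \<le> upper_const * (z - d) powr newman_exponent"
    if "0 < z" "0 \<le> d" "d \<le> z" "w \<le> upper_const * z powr newman_exponent"
      "w \<le> c * z" "v \<le> w - c * d" for v w z d c :: real
  proof -
    have "v \<le> w - c * d" by fact
    also have "\<dots> \<le> w - w / z * d"
      using that by (intro diff_left_mono mult_right_mono) (simp_all add: field_simps)
    also have "\<dots> = w * (1 - d / z)"
      by (simp add: algebra_simps)
    also have "\<dots> \<le> upper_const * z powr newman_exponent * (1 - d / z)"
      using that by (intro mult_right_mono) (simp_all add: field_simps)
    also have "\<dots> \<le> upper_const * (z - d) powr newman_exponent"
      using powr_newman_exponent_shift_ge[of z d] that upper_const_pos by (simp add: mult.assoc)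
    finally show ?thesis .
  qed
  have "real_of_int (newman_quad (4 ^ k * a + b))
      \<le> upper_const * real (4 ^ k * a + b) powr newman_exponent" if "b < 4 ^ k" for k b
    using assms that
  proof (induction k arbitrary: a b)
    case 0
    have "real_of_int (newman_quad a) \<le> upper_const * ((real a + 2 / 3) - 2 / 3) powr newman_exponent"
      using 0 by (intro near_max[of _ _ "real_of_int (newman_quad a + 3)" "8 / 5"]) simp_all
    then show ?case using 0 by simp
  next
    case (Suc k)
    define z where "z = 4 * (real a + 2 / 3)"
    define w where "w = 3 * real_of_int (newman_quad a + 3)"
    \<comment> \<open>One level deeper the slope 8/5 shrinks by 3/4 to 6/5. This is exactly what
      digit 1 needs: its rise is 7 against 9 at distance 5/3, and
      \<open>9 - 6/5 * 5/3 = 7\<close>.\<close>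
    have w: "w \<le> upper_const * z powr newman_exponent" "w \<le> 6 / 5 * z"
      using Suc.prems(4,5) powr_newman_exponent_mult_4_power[of "real a + 2 / 3" 1]
      by (simp_all add: z_def w_def)
    note signs = thue_morse_triple_quad[of a] Suc.prems(1-3)
    have 0: "upper_cyl (4 * a)"
    proof (rule upper_cyl_leaf)
      have "real_of_int (cyl_sup (4 * a)) \<le> upper_const * (z - 8 / 3) powr newman_exponent"
        using w by (intro near_max[of z _ w "6 / 5"])
          (simp_all only: cyl_sup_def signs newman_quad_mult_4, simp_all add: z_def w_def)
      then show "real_of_int (cyl_sup (4 * a)) \<le> upper_const * real (4 * a) powr newman_exponent"
        by (simp add: z_def)
    qed
    have 1: "upper_cyl (4 * a + 1)"
    proof (rule upper_cyl_leaf)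
      have "real_of_int (cyl_sup (4 * a + 1)) \<le> upper_const * (z - 5 / 3) powr newman_exponent"
        using w by (intro near_max[of z _ w "6 / 5"])
          (simp_all only: cyl_sup_def signs newman_quad_quad, simp_all add: z_def w_def)
      then show "real_of_int (cyl_sup (4 * a + 1)) \<le> upper_const * real (4 * a + 1) powr newman_exponent"
        by (simp add: z_def add.commute)
    qed
    have 3: "upper_cyl (4 * a + 3)"
    proof (rule upper_cyl_leaf)
      \<comment> \<open>Digit 3 lies to the right of the extremal point, so monotonicity
        suffices.\<close>
      have "real_of_int (cyl_sup (4 * a + 3)) \<le> w"
        by (simp only: cyl_sup_def signs newman_quad_quad) (simp add: w_def)
      also have "\<dots> \<le> upper_const * z powr newman_exponent" by fact
      also have "\<dots> \<le> upper_const * real (4 * a + 3) powr newman_exponent"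
        using upper_const_pos by (intro mult_left_mono powr_newman_exponent_mono) (auto simp: z_def)
      finally show "real_of_int (cyl_sup (4 * a + 3)) \<le> upper_const * real (4 * a + 3) powr newman_exponent" .
    qed
    define r where "r = b div 4 ^ k"
    define b' where "b' = b mod 4 ^ k"
    have "r < 4"
      using Suc.prems(6) by (simp add: r_def less_mult_imp_div_less)
    have b': "b' < 4 ^ k" by (simp add: b'_def)
    have "real_of_int (newman_quad (4 ^ k * (4 * a + r) + b'))
      \<le> upper_const * real (4 ^ k * (4 * a + r) + b') powr newman_exponent"
    proof (cases "r = 2")
      case True
      have "real (4 * a + 2) + 2 / 3 = z" by (simp add: z_def)
      moreover have "real_of_int (newman_quad (4 * a + 2) + 3) = w"
        by (simp only: newman_quad_quad signs) (simp add: w_def)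
      ultimately show ?thesis
        unfolding True using w b' signs by (intro Suc.IH) simp_all
    next
      case False
      with \<open>r < 4\<close> 0 1 3 have "upper_cyl (4 * a + r)"
        by (cases r rule: less_4_cases) simp_all
      with b' show ?thesis unfolding upper_cyl_def by blast
    qed
    then show ?case
      unfolding cylinder_first_digit r_def b'_def .
  qed
  then show ?thesis by (simp add: upper_cyl_def)
qed

section \<open>The finite tree of cylinders for the upper bound\<close>

lemma upper_cyl_346_362: "upper_cyl 346" "upper_cyl 362"
proof -
  \<comment> \<open>346 and 362 are 11122 and 11222 in base 4; one level higher the slope condition
    8/5 still fails. At 346 the power comparison is an equality: \<open>495 = 9 * 55\<close> and
    \<open>346 + 2/3 = 16 * 65/3\<close>.\<close>
  show "upper_cyl 346"
  proof (rule upper_cyl_chain)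
    show "real_of_int (newman_quad 346 + 3) \<le> upper_const * (real 346 + 2 / 3) powr newman_exponent"
      by (rule le_upper_const_powr[where j = 2]) (simp_all add: power_divide)
  qed simp_all
  show "upper_cyl 362"
  proof (rule upper_cyl_chain)
    show "real_of_int (newman_quad 362 + 3) \<le> upper_const * (real 362 + 2 / 3) powr newman_exponent"
      by (rule le_upper_const_powr[where j = 2]) (simp_all add: power_divide)
  qed simp_all
qed

lemma upper_cyl_depth_2:
  "\<forall>a \<in> {7, 8, 9, 10, 11, 12, 13, 14, 15, 16, 17, 18, 19, 23, 24, 25, 26, 27}. upper_cyl a"
  unfolding ball_simps
  by (intro conjI TrueI; rule upper_cyl_leaf, rule le_upper_const_powr[where j = 0])
    (simp_all add: cyl_sup_def power_divide)

lemma upper_cyl_depth_3: "\<forall>a \<in> {80, 81, 82, 83, 84, 87, 88, 91}. upper_cyl a"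
  unfolding ball_simps
  by (intro conjI TrueI; rule upper_cyl_leaf, rule le_upper_const_powr[where j = 1])
    (simp_all add: cyl_sup_def power_divide)

lemma upper_cyl_depth_4:
  "\<forall>a \<in> {340, 341, 342, 343, 344, 345, 347, 356, 357, 358, 359, 360, 361, 363}. upper_cyl a"
  unfolding ball_simps
  by (intro conjI TrueI; rule upper_cyl_leaf, rule le_upper_const_powr[where j = 2])
    (simp_all add: cyl_sup_def power_divide)

lemma upper_cyl_1_2_3: "upper_cyl 1" "upper_cyl 2" "upper_cyl 3"
proof -
  note leaves = upper_cyl_depth_2 upper_cyl_depth_3 upper_cyl_depth_4 upper_cyl_346_362
  \<comment> \<open>The tree is assembled upwards; only the prefixes of the two chain cylinders are
    refined this deep.\<close>
  have 85: "upper_cyl 85" and 86: "upper_cyl 86" and 89: "upper_cyl 89" and 90: "upper_cyl 90"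
    by (rule upper_cyl_node; simp add: leaves)+
  have 20: "upper_cyl 20" and 21: "upper_cyl 21" and 22: "upper_cyl 22"
    by (rule upper_cyl_node; simp add: leaves 85 86 89 90)+
  have 4: "upper_cyl 4" and 5: "upper_cyl 5" and 6: "upper_cyl 6"
    by (rule upper_cyl_node; simp add: leaves 20 21 22)+
  show "upper_cyl 1" "upper_cyl 2" "upper_cyl 3"
    by (rule upper_cyl_node; simp add: leaves 4 5 6)+
qed

lemma newman_quad_upper:
  "real_of_int (newman_quad y) \<le> upper_const * real y powr newman_exponent"
proof (cases "y = 0")
  case False
  then obtain k a b where "1 \<le> a" "a < 4" "b < 4 ^ k" "y = 4 ^ k * a + b"
    using cylinder_exists[of 1 y] by auto
  moreover from this have "a = 1 \<or> a = 2 \<or> a = 3" by linarith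
  ultimately show ?thesis
    using upper_cyl_1_2_3 unfolding upper_cyl_def by blast
qed simp

text \<open>Along the digit 2 the left-hand side is only attained in the limit.\<close>

lemma newman_quad_chain_upper:
  assumes "thue_morse (3 * y) = 1" "thue_morse (3 * y + 1) = -1" "thue_morse (3 * y + 2) = 1"
  shows "real_of_int (newman_quad y) + 3 \<le> upper_const * (real y + 2 / 3) powr newman_exponent"
proof -
  \<comment> \<open>The witness is \<open>y\<close> with \<open>j\<close> digits 2 appended.\<close>
  have chain: "\<exists>z. real z + 2 / 3 = 4 ^ j * (real y + 2 / 3) \<and>
      newman_quad z + 3 = 3 ^ j * (newman_quad y + 3)" for j
    using assms
  proof (induction j arbitrary: y)
    case 0
    show ?case by (rule exI[of _ y]) simp
  next
    case (Suc j)
    note signs = thue_morse_triple_quad[of y] Suc.prems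
    have "real (4 * y + 2) + 2 / 3 = 4 * (real y + 2 / 3)" by simp
    moreover have "newman_quad (4 * y + 2) + 3 = 3 * (newman_quad y + 3)"
      by (simp only: newman_quad_quad signs) simp
    moreover have "\<exists>z. real z + 2 / 3 = 4 ^ j * (real (4 * y + 2) + 2 / 3) \<and>
        newman_quad z + 3 = 3 ^ j * (newman_quad (4 * y + 2) + 3)"
      using signs by (intro Suc.IH) simp_all
    ultimately show ?case
      by (simp only: power_Suc mult_ac)
  qed
  define A where "A = real_of_int (newman_quad y) + 3"
  define B where "B = upper_const * (real y + 2 / 3) powr newman_exponent"
  \<comment> \<open>The bound at \<open>z\<close>, enlarged to \<open>z + 2/3\<close> and divided by
    \<open>3 ^ j\<close>; the surplus 3 vanishes in the limit.\<close>
  have le: "A \<le> B + 3 * (1 / 3) ^ j" for j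
  proof -
    from chain[of j] obtain z where z: "real z + 2 / 3 = 4 ^ j * (real y + 2 / 3)"
        "newman_quad z + 3 = 3 ^ j * (newman_quad y + 3)" by blast
    from z(2) have "3 ^ j * A = real_of_int (newman_quad z) + 3"
      unfolding A_def by (metis of_int_add of_int_mult of_int_numeral of_int_power)
    also have "\<dots> \<le> upper_const * real z powr newman_exponent + 3"
      using newman_quad_upper by simp
    also have "\<dots> \<le> upper_const * (real z + 2 / 3) powr newman_exponent + 3"
      using upper_const_pos by (simp add: powr_newman_exponent_mono)
    also have "\<dots> = 3 ^ j * B + 3"
      unfolding z(1) B_def by (simp add: powr_newman_exponent_mult_4_power)
    finally show ?thesis
      by (simp add: field_simps)
  qed
  have "(\<lambda>j. B + 3 * (1 / 3) ^ j) \<longlonglongrightarrow> B + 3 * 0"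
    by (intro tendsto_intros LIMSEQ_realpow_zero) simp_all
  then have "A \<le> B + 3 * 0"
    by (rule LIMSEQ_le_const) (use le in blast)
  then show ?thesis
    by (simp add: A_def B_def)
qed

text \<open>Three times \<open>newman_sum x\<close> is at most some \<open>newman_quad z\<close>
  with \<open>z \<le> x\<close> in the block of \<open>4 * y\<close>, except at digit 3 with signs
  1, -1, 1.\<close>

lemma newman_sum_upper:
  "real_of_int (newman_sum x) \<le> upper_const / 3 * real x powr newman_exponent"
proof -
  define y where "y = x div 4"
  have x: "x = 4 * y + x mod 4"
    by (simp add: y_def)
  define e0 e1 e2 where e: "e0 = thue_morse (3 * y)" "e1 = thue_morse (3 * y + 1)"
    "e2 = thue_morse (3 * y + 2)"
  have e_cases: "e0 = 1 \<or> e0 = -1" "e1 = 1 \<or> e1 = -1" "e2 = 1 \<or> e2 = -1"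
    unfolding e by (rule thue_morse_cases)+
  note sums = newman_sum_quad[of y, folded e]
  note quads = newman_quad_mult_4[of y] newman_quad_quad[of y, folded e]
  define bound where "bound z = upper_const * z powr newman_exponent" for z :: real
  have mono: "bound u \<le> bound v" if "0 \<le> u" "u \<le> v" for u v
    unfolding bound_def using that upper_const_pos
    by (intro mult_left_mono powr_newman_exponent_mono) auto
  have quad: "real_of_int (newman_quad z) \<le> bound (real x)" if "z \<le> x" for z
    using newman_quad_upper[of z] mono[of "real z" "real x"] that by (simp add: bound_def)
  have "x mod 4 < 4" by simp
  then have "3 * real_of_int (newman_sum x) \<le> bound (real x)"
  proof (cases rule: less_4_cases)
    case 1
    then show ?thesis
      using x sums quads quad[of "4 * y"] by simp
  next
    case 2
    then have "newman_sum x = newman_quad y + e0" "4 * y + 1 = x"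
      using x sums by simp_all
    then show ?thesis
      using e_cases quads quad[of "4 * y"] quad[of "4 * y + 1"] by auto
  next
    case 3
    then have "newman_sum x = newman_quad y + 2 * e0" "4 * y + 2 = x"
      using x sums by (metis, simp)
    then show ?thesis
      using quads quad[of "4 * y + 2"] by simp
  next
    case 4
    then have *: "newman_sum x = newman_quad y + 2 * e0 - e1" "4 * y + 3 = x"
      using x sums by (metis, simp)
    show ?thesis
    proof (cases "e0 = 1 \<and> e1 = -1 \<and> e2 = 1")
      \<comment> \<open>Here \<open>3 * newman_sum x\<close> is
        \<open>3 * newman_quad y + 9\<close>, one more than \<open>newman_quad (4 * y + 3)\<close>;
        the limit point \<open>4 * (y + 2/3)\<close>, still below \<open>x\<close>, supplies
        it.\<close>
      case True
      then have "3 * real_of_int (newman_sum x) \<le> 3 * bound (real y + 2 / 3)"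
        using newman_quad_chain_upper[of y] *(1) by (simp add: e bound_def)
      also have "\<dots> = bound (4 * (real y + 2 / 3))"
        using powr_newman_exponent_mult_4_power[of "real y + 2 / 3" 1] by (simp add: bound_def)
      also have "\<dots> \<le> bound (real x)"
        using *(2) by (intro mono) auto
      finally show ?thesis .
    next
      case False
      have "newman_quad (4 * y) \<le> bound (real x)" "newman_quad (4 * y + 1) \<le> bound (real x)"
        "newman_quad (4 * y + 3) \<le> bound (real x)"
        by (rule quad; use *(2) in simp)+
      then show ?thesis
        using False e_cases unfolding quads *(1) by auto
    qed
  qed
  then show ?thesis by (simp add: bound_def)
qed

section \<open>The lower bound\<close>

text \<open>\<open>newman_sum\<close> can fall below the values of the rescaled \<open>newman_quad\<close> around it, so unlike the
  upper bound this one is proved for \<open>newman_sum\<close> directly.\<close>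

lemma lower_const_powr:
  "2 * sqrt 3 / 3 * real x powr newman_exponent = 2 * (real x / 2) powr newman_exponent"
proof -
  have "real x powr newman_exponent = sqrt 3 * (real x / 2) powr newman_exponent"
    using powr_mult[of 2 "real x / 2" newman_exponent] by (simp add: powr_newman_exponent_2)
  then show ?thesis by simp
qed

definition lower_cyl :: "nat \<Rightarrow> bool" where
  "lower_cyl a \<longleftrightarrow> (\<forall>k b. b < 4 ^ k \<longrightarrow>
     2 * (real (4 ^ k * a + b) / 2) powr newman_exponent
       \<le> real_of_int (newman_sum (4 ^ k * a + b)))"

lemma powr_le_of_power_le:
  fixes z v :: real
  assumes "2 * 4 ^ j \<le> z" "(z / (2 * 4 ^ j)) ^ 4 \<le> (v / (2 * 3 ^ j)) ^ 5" "0 \<le> v"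
  shows "2 * (z / 2) powr newman_exponent \<le> v"
proof -
  have "0 < (2::real) * 4 ^ j" by simp
  then have "0 \<le> z" using assms(1) by linarith
  then have "(z / 2) powr newman_exponent = 3 ^ j * (z / (2 * 4 ^ j)) powr newman_exponent"
    using powr_newman_exponent_mult_4_power[of "z / (2 * 4 ^ j)" j] by simp
  moreover have "(z / (2 * 4 ^ j)) powr newman_exponent \<le> v / (2 * 3 ^ j)"
  proof (rule powr_newman_exponent_le)
    show "1 \<le> z / (2 * 4 ^ j)"
      using assms(1) by (simp add: le_divide_eq)
  qed (use assms in simp_all)
  ultimately show ?thesis
    by (simp add: field_simps)
qed

text \<open>The power is now taken at the right end \<open>a + 1\<close>. The division by 3 reflects
  the digit lost in \<open>newman_sum_cylinder\<close>.\<close>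

lemma lower_cyl_leaf:
  assumes "2 * (real a / 2) powr newman_exponent \<le> real_of_int (newman_sum a)"
    and "2 * ((real a + 1) / 2) powr newman_exponent \<le> real_of_int (cyl_inf a) / 3"
  shows "lower_cyl a"
  unfolding lower_cyl_def
proof (intro allI impI)
  fix k b :: nat
  assume b: "b < 4 ^ k"
  show "2 * (real (4 ^ k * a + b) / 2) powr newman_exponent
      \<le> real_of_int (newman_sum (4 ^ k * a + b))"
  proof (cases k)
    case 0
    then show ?thesis using assms(1) b by simp
  next
    case (Suc m)
    have "real b \<le> 4 ^ k"
      using b by (metis less_imp_le of_nat_le_iff of_nat_numeral of_nat_power)
    then have "real (4 ^ k * a + b) \<le> 4 ^ k * (real a + 1)"
      by (simp add: distrib_left)
    then have "2 * (real (4 ^ k * a + b) / 2) powr newman_exponent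
        \<le> 2 * (4 ^ k * ((real a + 1) / 2)) powr newman_exponent"
      by (intro mult_left_mono powr_newman_exponent_mono) simp_all
    also have "\<dots> = 3 ^ k * (2 * ((real a + 1) / 2) powr newman_exponent)"
      by (subst powr_newman_exponent_mult_4_power) simp_all
    also have "\<dots> \<le> 3 ^ k * (real_of_int (cyl_inf a) / 3)"
      using assms(2) by (intro mult_left_mono) simp_all
    also have "\<dots> = real_of_int (3 ^ m * cyl_inf a)"
      by (simp add: Suc)
    also have "\<dots> \<le> real_of_int (newman_sum (4 ^ k * a + b))"
      using newman_sum_cylinder[of b m a] b unfolding Suc of_int_le_iff by blast
    finally show ?thesis .
  qed
qed

text \<open>As \<open>newman_sum\<close> lacks exact scaling, the value at \<open>a\<close> cannot
  be read off from the child \<open>4 * a\<close> and is assumed.\<close>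

lemma lower_cyl_node:
  assumes "2 * (real a / 2) powr newman_exponent \<le> real_of_int (newman_sum a)"
    and "lower_cyl (4 * a)" "lower_cyl (4 * a + 1)" "lower_cyl (4 * a + 2)" "lower_cyl (4 * a + 3)"
  shows "lower_cyl a"
  unfolding lower_cyl_def
proof (intro allI impI)
  fix k b :: nat
  assume b: "b < 4 ^ k"
  show "2 * (real (4 ^ k * a + b) / 2) powr newman_exponent
      \<le> real_of_int (newman_sum (4 ^ k * a + b))"
  proof (cases k)
    case 0
    then show ?thesis using assms(1) b by simp
  next
    case (Suc m)
    have "b div 4 ^ m < 4"
      using b Suc by (simp add: less_mult_imp_div_less)
    then have "lower_cyl (4 * a + b div 4 ^ m)"
      using assms by (cases rule: less_4_cases) simp_all
    moreover have "b mod 4 ^ m < 4 ^ m" by simp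
    ultimately show ?thesis
      unfolding Suc cylinder_first_digit lower_cyl_def by blast
  qed
qed

text \<open>Here the extremal point is \<open>a\<close> itself; descending along the digit 0 reproduces the
  hypotheses.\<close>

lemma lower_cyl_chain:
  assumes "thue_morse (3 * a) = 1" "thue_morse (3 * a + 1) = -1" "thue_morse (3 * a + 2) = -1"
    and "2 * (real a / 2) powr newman_exponent \<le> real_of_int (newman_sum a)"
    and "6 * (real a / 2) powr newman_exponent \<le> real_of_int (newman_quad a)"
    and "0 < a" "3 * newman_quad a \<le> 8 * int a"
  shows "lower_cyl a"
proof -
  have "2 * (real (4 ^ k * a + b) / 2) powr newman_exponent
      \<le> real_of_int (newman_sum (4 ^ k * a + b))" if "b < 4 ^ k" for k b
    using assms that
  proof (induction k arbitrary: a b)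
    case 0
    then show ?case by simp
  next
    case (Suc k)
    define q where "q = real_of_int (newman_quad a)"
    have q: "6 * (real a / 2) powr newman_exponent \<le> q" "3 * q \<le> 8 * real a" "0 < real a"
      using Suc.prems unfolding q_def by linarith+
    \<comment> \<open>The bound grows from \<open>4 * a\<close> with slope at most
      \<open>q / (4 * a) \<le> 2/3\<close>. The right ends of digits 1 and 2 need exactly this: one
      third of their infima is \<open>q + 4/3\<close> and \<open>q + 2\<close>, at distances 2 and
      3.\<close>
    have near_min: "2 * ((4 * real a + d) / 2) powr newman_exponent \<le> q + 2 / 3 * d"
      if "0 \<le> d" for d
    proof -
      have eq: "(4 * real a + d) / 2 = 4 ^ 1 * (real a / 2 + d / 8)"
        by simp
      have "2 * ((4 * real a + d) / 2) powr newman_exponent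
          = 6 * (real a / 2 + d / 8) powr newman_exponent"
        unfolding eq using that by (subst powr_newman_exponent_mult_4_power) simp_all
      also have "\<dots> \<le> 6 * ((real a / 2) powr newman_exponent * (1 + d / 8 / (real a / 2)))"
        using that q by (intro mult_left_mono powr_newman_exponent_shift_le) simp_all
      also have "\<dots> \<le> q * (1 + d / 8 / (real a / 2))"
        unfolding mult.assoc[symmetric] using that q by (intro mult_right_mono) simp_all
      also have "\<dots> = q + q / (4 * real a) * d"
        using q by (simp add: field_simps)
      also have "\<dots> \<le> q + 2 / 3 * d"
        using that q by (intro add_left_mono mult_right_mono) (simp_all add: field_simps)
      finally show ?thesis .
    qed
    note signs = thue_morse_triple_quad[of a] Suc.prems(1-3)
    have 1: "lower_cyl (4 * a + 1)"
    proof (rule lower_cyl_leaf)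
      have "newman_sum (4 * a + 1) = newman_quad a + 1" "cyl_inf (4 * a + 1) = 3 * newman_quad a + 4"
        by (simp_all only: cyl_inf_def newman_sum_quad newman_quad_quad signs) simp_all
      then show "2 * (real (4 * a + 1) / 2) powr newman_exponent \<le> real_of_int (newman_sum (4 * a + 1))"
        "2 * ((real (4 * a + 1) + 1) / 2) powr newman_exponent \<le> real_of_int (cyl_inf (4 * a + 1)) / 3"
        using near_min[of 1] near_min[of 2] by (simp_all add: q_def add_ac)
    qed
    have 2: "lower_cyl (4 * a + 2)"
    proof (rule lower_cyl_leaf)
      have "newman_sum (4 * a + 2) = newman_quad a + 2" "cyl_inf (4 * a + 2) = 3 * newman_quad a + 6"
        by (simp_all only: cyl_inf_def newman_sum_quad newman_quad_quad signs) simp_all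
      then show "2 * (real (4 * a + 2) / 2) powr newman_exponent \<le> real_of_int (newman_sum (4 * a + 2))"
        "2 * ((real (4 * a + 2) + 1) / 2) powr newman_exponent \<le> real_of_int (cyl_inf (4 * a + 2)) / 3"
        using near_min[of 2] near_min[of 3] by (simp_all add: q_def add_ac)
    qed
    have 3: "lower_cyl (4 * a + 3)"
    proof (rule lower_cyl_leaf)
      have "newman_sum (4 * a + 3) = newman_quad a + 3" "cyl_inf (4 * a + 3) = 3 * newman_quad a + 10"
        by (simp_all only: cyl_inf_def newman_sum_quad newman_quad_quad signs) simp_all
      then show "2 * (real (4 * a + 3) / 2) powr newman_exponent \<le> real_of_int (newman_sum (4 * a + 3))"
        "2 * ((real (4 * a + 3) + 1) / 2) powr newman_exponent \<le> real_of_int (cyl_inf (4 * a + 3)) / 3"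
        using near_min[of 3] near_min[of 4] by (simp_all add: q_def add_ac)
    qed
    define r where "r = b div 4 ^ k"
    define b' where "b' = b mod 4 ^ k"
    have "r < 4"
      using Suc.prems(8) by (simp add: r_def less_mult_imp_div_less)
    have b': "b' < 4 ^ k" by (simp add: b'_def)
    have "2 * (real (4 ^ k * (4 * a + r) + b') / 2) powr newman_exponent
      \<le> real_of_int (newman_sum (4 ^ k * (4 * a + r) + b'))"
    proof (cases "r = 0")
      case True
      have "2 * (real (4 * a) / 2) powr newman_exponent \<le> real_of_int (newman_sum (4 * a))"
        using near_min[of 0] by (simp add: newman_sum_quad q_def)
      moreover from this
      have "6 * (real (4 * a) / 2) powr newman_exponent \<le> real_of_int (newman_quad (4 * a))"
        by (simp add: newman_sum_quad newman_quad_mult_4)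
      ultimately show ?thesis
        unfolding True add_0_right using Suc.prems(6,7) b' signs
        by (intro Suc.IH) (simp_all add: newman_quad_mult_4)
    next
      case False
      with \<open>r < 4\<close> 1 2 3 have "lower_cyl (4 * a + r)"
        by (cases r rule: less_4_cases) simp_all
      with b' show ?thesis unfolding lower_cyl_def by blast
    qed
    then show ?case
      unfolding cylinder_first_digit r_def b'_def .
  qed
  then show ?thesis by (simp add: lower_cyl_def)
qed

section \<open>The finite tree of cylinders for the lower bound\<close>

lemma lower_cyl_5_6: "lower_cyl 5" "lower_cyl 6"
  by (rule lower_cyl_leaf; rule powr_le_of_power_le[where j = 0];
      simp add: cyl_inf_def power_divide)+

lemma lower_cyl_7: "lower_cyl 7"
proof (rule lower_cyl_leaf)
  show "2 * (real 7 / 2) powr newman_exponent \<le> real_of_int (newman_sum 7)"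
    by (rule powr_le_of_power_le[where j = 0]) (simp_all add: power_divide)
  \<comment> \<open>An equality, as the right end 8 is extremal and \<open>cyl_inf 7 = 18\<close>;
    with \<open>j = 1\<close> the base is exactly 1.\<close>
  show "2 * ((real 7 + 1) / 2) powr newman_exponent \<le> real_of_int (cyl_inf 7) / 3"
    by (rule powr_le_of_power_le[where j = 1]) (simp_all add: cyl_inf_def)
qed

text \<open>The chain starts at 8, which is 20 in base 4: the slope condition reads
  \<open>54 \<le> 64\<close> here, but would read \<open>18 \<le> 16\<close> at 2.\<close>

lemma lower_cyl_8: "lower_cyl 8"
proof (rule lower_cyl_chain)
  show "2 * (real 8 / 2) powr newman_exponent \<le> real_of_int (newman_sum 8)"
    by (rule powr_le_of_power_le[where j = 1]) simp_all
  then show "6 * (real 8 / 2) powr newman_exponent \<le> real_of_int (newman_quad 8)"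
    by simp
qed simp_all

lemma lower_cyl_9_to_19:
  "\<forall>a \<in> {9, 10, 11, 12, 13, 14, 15, 16, 17, 18, 19}. lower_cyl a"
  unfolding ball_simps
  by (intro conjI TrueI; rule lower_cyl_leaf; rule powr_le_of_power_le[where j = 1];
      simp add: cyl_inf_def power_divide)

lemma lower_cyl_2_3_4: "lower_cyl 2" "lower_cyl 3" "lower_cyl 4"
proof -
  have *: "2 * (real 2 / 2) powr newman_exponent \<le> real_of_int (newman_sum 2)"
    "2 * (real 3 / 2) powr newman_exponent \<le> real_of_int (newman_sum 3)"
    "2 * (real 4 / 2) powr newman_exponent \<le> real_of_int (newman_sum 4)"
    by (rule powr_le_of_power_le[where j = 0]; simp add: power_divide)+
  show "lower_cyl 2" "lower_cyl 3" "lower_cyl 4"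
    by (rule lower_cyl_node; use * in \<open>simp add: lower_cyl_8 lower_cyl_9_to_19\<close>)+
qed

lemma newman_sum_lower:
  assumes "2 \<le> x"
  shows "2 * sqrt 3 / 3 * real x powr newman_exponent \<le> real_of_int (newman_sum x)"
proof -
  \<comment> \<open>The roots start at 2 because the bound fails at 1, which lies in its own
    cylinder.\<close>
  obtain k a b where "2 \<le> a" "a < 8" and b: "b < 4 ^ k" and x: "x = 4 ^ k * a + b"
    using cylinder_exists[of 2 x] assms by auto
  then have "a = 2 \<or> a = 3 \<or> a = 4 \<or> a = 5 \<or> a = 6 \<or> a = 7" by linarith
  then have "lower_cyl a"
    using lower_cyl_2_3_4 lower_cyl_5_6 lower_cyl_7 by auto
  then show ?thesis
    using b unfolding x lower_const_powr lower_cyl_def by blast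
qed

theorem mainTheorem1:
  fixes x :: nat
  assumes "x \<ge> 2"
  shows "2 * sqrt 3 / 3 * real x powr newman_exponent \<le> real_of_int (S_3_0 (3 * x)) \<and>
         real_of_int (S_3_0 (3 * x))
           \<le> 55 / 3 * (3 / 65) powr newman_exponent * real x powr newman_exponent"
  using newman_sum_lower[OF assms] newman_sum_upper[of x]
  by (simp add: S_3_0_mult_3 upper_const_def)

end
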